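(* Let $t,n\in\mathbb{N}$, let $0<p<1$, and let $\mathbf{X}=(X_1,\ldots,X_n)$ where $X_1,\ldots,X_n$ are i.i.d. with $X_i\sim\mathrm{Geom}(p)$. Put $T(\mathbf{X})=\sum_{i=1}^nX_i$. Let $(k_1,\ldots,k_{n-1})$ be the random sample drawn by the bar-drawing algorithm with input $t$ and $n$ (described in the context), and let $\phi$ be the map $$\phi(k_1,k_2,\ldots,k_{n-1})=\big(k_1-1,\ (k_2-2)-(k_1-1),\ \ldots,\ (k_{n-1}-(n-1))-(k_{n-2}-(n-2)),\ t-(k_{n-1}-(n-1))\big).$$ Then $\phi(k_1,k_2,\ldots,k_{n-1})$ is distributed as the conditional distribution of $\mathbf{X}$ given $T(\mathbf{X})=t$: $$\phi(k_1,k_2,\ldots,k_{n-1})\sim \mathbf{X}\;|\;T(\mathbf{X})=t.$$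
   Context: $\mathbb{N}=\{1,2,3,\ldots\}$. $X\sim\mathrm{Geom}(p)$ means $\mathbf{P}(X=x)=p(1-p)^x$ for $x=0,1,2,\ldots$. With the convention $k_0=0$, the $i$-th coordinate of $\phi(k_1,\ldots,k_{n-1})$ is $(k_i-i)-(k_{i-1}-(i-1))$ for $1\le i\le n-1$, and the $n$-th coordinate is $t-(k_{n-1}-(n-1))$ (so for $n=1$ the empty tuple is mapped to $(t)$). Bar-drawing algorithm, with input $t,n\in\mathbb{N}$ and output $k_1,\ldots,k_{n-1}$. Initialize $N=0$ (number of accepted integers), $V=0$ (number of not accepted integers), and $I=t+n-1$ (the integer currently considered). While $N<n-1$, repeat the following iteration: draw $u$ from the uniform distribution on $[0,1]$, independently of all previous draws. - If $u<\dfrac{n-1-N}{t+n-1-N-V}$, then the integer $I$ is accepted: set $k_{n-1-N}=I$, then increase $N$ by $1$ and decrease $I$ by $1$, and go to the next iteration. - If $u\ge\dfrac{n-1-N}{t+n-1-N-V}$, then the integer $I$ is not accepted: increase $V$ by $1$ and decrease $I$ by $1$, and go to the next iteration. The algorithm stops when $N=n-1$ and returns $(k_1,\ldots,k_{n-1})$. *)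

theory Defs
  imports "HOL-Probability.Probability" "HOL-Library.While_Combinator"
begin

text \<open>
  \<open>cur\<close> and the values of \<open>bars\<close> are integers because on a null set of draws the loop can
  run past \<open>I = 1\<close>; only there can the denominator of \<open>bar_threshold\<close> vanish.  The array \<open>bars\<close> is indexed from \<open>1\<close>; its initial contents are irrelevant.
\<close>

record bar_state =
  accepted :: nat
  rejected :: nat
  cur :: int
  bars :: "nat \<Rightarrow> int"

definition bar_init :: "nat \<Rightarrow> nat \<Rightarrow> bar_state" where
  "bar_init t n =
     \<lparr>accepted = 0, rejected = 0, cur = int t + int n - 1, bars = (\<lambda>_. 0)\<rparr>"

definition bar_threshold :: "nat \<Rightarrow> nat \<Rightarrow> bar_state \<Rightarrow> real" where
  "bar_threshold t n s =
     (real n - 1 - real (accepted s)) /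
     (real t + real n - 1 - real (accepted s) - real (rejected s))"

definition bar_step :: "nat \<Rightarrow> nat \<Rightarrow> real \<Rightarrow> bar_state \<Rightarrow> bar_state" where
  "bar_step t n u s =
     (if u < bar_threshold t n s
      then s\<lparr>accepted := accepted s + 1, cur := cur s - 1,
             bars := (bars s)(n - 1 - accepted s := cur s)\<rparr>
      else s\<lparr>rejected := rejected s + 1, cur := cur s - 1\<rparr>)"

text \<open>
  The loop state is paired with the iteration counter \<open>m\<close>: iteration \<open>m\<close> uses the draw \<open>u m\<close>.
  The result is \<open>None\<close> if the loop does not terminate on the given sequence of draws.
\<close>

definition bar_drawing :: "nat \<Rightarrow> nat \<Rightarrow> (nat \<Rightarrow> real) \<Rightarrow> int list option" where
  "bar_drawing t n u =
     map_option (\<lambda>(m, s). map (bars s) [1..<n])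
       (while_option (\<lambda>(m, s). accepted s < n - 1)
          (\<lambda>(m, s). (m + 1, bar_step t n (u m) s))
          (0::nat, bar_init t n))"

text \<open>
  The argument \<open>ks\<close> is the list of \<open>k 1, \<dots>, k (n - 1)\<close>; prepending \<open>0\<close> implements \<open>k 0 = 0\<close>.
\<close>

definition phi :: "nat \<Rightarrow> int list \<Rightarrow> int list" where
  "phi t ks =
     (let n = length ks + 1; k = (\<lambda>i. (0 # ks) ! i) in
        map (\<lambda>i. (k i - int i) - (k (i - 1) - int (i - 1))) [1..<n]
        @ [int t - (k (n - 1) - int (n - 1))])"

text \<open>The conditional law of \<open>Y\<close> given an event \<open>E\<close> of positive probability.\<close>

definition cond_law :: "'a measure \<Rightarrow> 'a set \<Rightarrow> 'b measure \<Rightarrow> ('a \<Rightarrow> 'b) \<Rightarrow> 'b measure" where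
  "cond_law M E N Y = distr (uniform_measure M E) N Y"

end

theory Submission
  imports Defs
begin

text \<open>
  Both laws are the uniform distribution on the weak compositions of \<open>t\<close> into \<open>n\<close> parts.

  For the conditioned geometric variables this is so because the joint mass
  \<open>p ^ n * (1 - p) ^ (x 1 + \<dots> + x n)\<close> depends on the sum alone
  (\<open>cond_law_geometric\<close>).

  For the algorithm, the outcome of a run depends only on the word of accept/reject decisions,
  and that \<open>k\<close> decisions spell a given word is an intersection of independent events, one for
  each draw.  The thresholds are those of sequential sampling: with \<open>r\<close> integers still to be
  accepted among \<open>D\<close>, the two decisions have probabilities \<open>r / D\<close> and \<open>1 - r / D\<close>, the
  ratios of \<open>D - 1 choose (r - 1)\<close> and \<open>D - 1 choose r\<close> to \<open>D choose r\<close>.  Hence the product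
  telescopes (\<open>prob_decisions\<close>), and every word at the end of which nothing remains to be
  accepted has probability \<open>1 / (t + n - 1 choose (n - 1))\<close>.  A composition \<open>x\<close> is reached
  along such a word, the one in which the runs of rejections have lengths
  \<open>x n, \<dots>, x 2\<close> (\<open>phi_bar_drawing_gap_word\<close>).

  So each composition is output with probability at least the reciprocal of the number of
  compositions.  As probabilities add up to at most \<open>1\<close>, equality holds and nothing else has
  positive probability (\<open>eq_pmf_of_setI\<close>).  Almost sure termination is part of this
  conclusion.
\<close>

section \<open>Runs as words of decisions\<close>

text \<open>
  A state is a function of the finite list of decisions that led to it.  Words of booleans form
  a countable type, unlike the states, which makes measurability and the computation of
  probabilities elementary.
\<close>

definition bar_move :: "nat \<Rightarrow> bar_state \<Rightarrow> bool \<Rightarrow> bar_state" where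
  "bar_move n s b =
     (if b
      then s\<lparr>accepted := accepted s + 1, cur := cur s - 1,
             bars := (bars s)(n - 1 - accepted s := cur s)\<rparr>
      else s\<lparr>rejected := rejected s + 1, cur := cur s - 1\<rparr>)"

definition replay :: "nat \<Rightarrow> nat \<Rightarrow> bool list \<Rightarrow> bar_state" where
  "replay t n bs = foldl (bar_move n) (bar_init t n) bs"

lemma replay_Nil [simp]: "replay t n [] = bar_init t n"
  by (simp add: replay_def)

lemma replay_snoc [simp]: "replay t n (bs @ [b]) = bar_move n (replay t n bs) b"
  by (simp add: replay_def)

primrec decisions :: "nat \<Rightarrow> nat \<Rightarrow> (nat \<Rightarrow> real) \<Rightarrow> nat \<Rightarrow> bool list" where
  "decisions t n u 0 = []"
| "decisions t n u (Suc k) =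
     decisions t n u k @ [u k < bar_threshold t n (replay t n (decisions t n u k))]"

lemma length_decisions [simp]: "length (decisions t n u k) = k"
  by (induction k) auto

lemma take_decisions: "j \<le> k \<Longrightarrow> take j (decisions t n u k) = decisions t n u j"
  by (induction k) (auto simp: le_Suc_eq)

text \<open>
  The thresholds on the right depend on the fixed word \<open>bs\<close> and no longer on the draws; this
  turns an adaptive procedure into independent conditions on the single draws.
\<close>

lemma decisions_eq_iff:
  "decisions t n u (length bs) = bs \<longleftrightarrow>
     (\<forall>i<length bs. (u i < bar_threshold t n (replay t n (take i bs))) = bs ! i)"
  by (induction bs rule: rev_induct) (auto simp: nth_append less_Suc_eq)

lemma loop_iterate:
  "((\<lambda>(m, s). (m + 1, bar_step t n (u m) s)) ^^ k) (0, bar_init t n) =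
     (k, replay t n (decisions t n u k))"
  by (induction k) (auto simp: bar_step_def bar_move_def)

lemma bar_drawing_decisions:
  "bar_drawing t n u =
     (if \<exists>k. \<not> accepted (replay t n (decisions t n u k)) < n - 1
      then Some (map (bars (replay t n (decisions t n u
             (LEAST k. \<not> accepted (replay t n (decisions t n u k)) < n - 1)))) [1..<n])
      else None)"
  unfolding bar_drawing_def while_option_def loop_iterate by simp

lemma accepted_replay [simp]: "accepted (replay t n bs) = count_list bs True"
  by (induction bs rule: rev_induct) (auto simp: bar_init_def bar_move_def)

lemma rejected_replay [simp]: "rejected (replay t n bs) = count_list bs False"
  by (induction bs rule: rev_induct) (auto simp: bar_init_def bar_move_def)

lemma cur_replay [simp]: "cur (replay t n bs) = int t + int n - 1 - int (length bs)"
  by (induction bs rule: rev_induct) (auto simp: bar_init_def bar_move_def)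

lemma count_list_True_False: "count_list bs True + count_list bs False = length bs"
  by (induction bs) auto

lemma bar_threshold_replay:
  assumes "1 \<le> n" and "count_list bs True \<le> n - 1" and "length bs \<le> t + n - 1"
  shows "bar_threshold t n (replay t n bs) =
    real (n - 1 - count_list bs True) / real (t + n - 1 - length bs)"
proof -
  have "real (count_list bs False) = real (length bs) - real (count_list bs True)"
    by (simp flip: count_list_True_False[of bs])
  then show ?thesis
    using assms by (simp add: bar_threshold_def of_nat_diff algebra_simps)
qed

section \<open>The word of decisions leading to a composition\<close>

text \<open>
  The integers are considered in decreasing order, so the gaps below are listed from the last
  part of the composition down to its second part; the first part is what remains below the
  smallest accepted integer when the loop stops.
\<close>

definition gap_word :: "nat list \<Rightarrow> bool list" where
  "gap_word ys = concat (map (\<lambda>y. replicate y False @ [True]) ys)"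

lemma gap_word_Nil [simp]: "gap_word [] = []"
  by (simp add: gap_word_def)

lemma gap_word_snoc [simp]: "gap_word (ys @ [y]) = gap_word ys @ replicate y False @ [True]"
  by (simp add: gap_word_def)

lemma count_list_replicate: "count_list (replicate k x) y = (if x = y then k else 0)"
  by (induction k) auto

lemma length_gap_word [simp]: "length (gap_word ys) = sum_list ys + length ys"
  by (induction ys rule: rev_induct) auto

lemma count_gap_word [simp]: "count_list (gap_word ys) True = length ys"
  by (induction ys rule: rev_induct) (auto simp: count_list_replicate)

text \<open>A gap word ends with an acceptance, so the loop does not stop before its end.\<close>

lemma count_take_gap_word:
  assumes "j < length (gap_word ys)"
  shows "count_list (take j (gap_word ys)) True < length ys"
proof (cases ys rule: rev_cases)
  case Nil
  then show ?thesis using assms by simp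
next
  case (snoc zs z)
  define w where "w = gap_word zs @ replicate z False"
  have w: "gap_word ys = w @ [True]" by (simp add: snoc w_def)
  have "count_list (take j w) True \<le> count_list (take j w) True + count_list (drop j w) True"
    by simp
  also have "\<dots> = count_list w True"
    by (metis append_take_drop_id count_list_append)
  also have "\<dots> < length ys"
    by (simp add: w_def snoc count_list_replicate)
  finally show ?thesis
    using assms by (simp add: w)
qed

lemma bars_replay_rejects:
  "bars (replay t n (bs @ replicate y False)) = bars (replay t n bs)"
proof (induction y)
  case (Suc y)
  have "bs @ replicate (Suc y) False = (bs @ replicate y False) @ [False]"
    by (simp add: replicate_append_same)
  then show ?case
    using Suc by (simp only: replay_snoc) (simp add: bar_move_def)
qed simp

lemma bars_replay_gap_word:
  assumes "length ys \<le> n - 1" and "i < length ys"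
  shows "bars (replay t n (gap_word ys)) (n - 1 - i) =
    int t + int n - 1 - int (sum_list (take (Suc i) ys)) - int i"
  using assms
proof (induction ys rule: rev_induct)
  case (snoc y ys)
  define w where "w = gap_word ys @ replicate y False"
  have w: "gap_word (ys @ [y]) = w @ [True]" by (simp add: w_def)
  have acc: "count_list w True = length ys"
    by (simp add: w_def count_list_replicate)
  have len: "length w = sum_list ys + length ys + y"
    by (simp add: w_def)
  have old: "bars (replay t n w) = bars (replay t n (gap_word ys))"
    by (simp add: w_def bars_replay_rejects)
  have new: "bars (replay t n (gap_word (ys @ [y]))) =
      (bars (replay t n (gap_word ys)))(n - 1 - length ys :=
         int t + int n - 1 - int (length w))"
    unfolding w replay_snoc by (simp add: bar_move_def acc old)
  show ?case
  proof (cases "i = length ys")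
    case True
    then show ?thesis unfolding new by (simp add: len)
  next
    case False
    with snoc.prems have "i < length ys" "n - 1 - i \<noteq> n - 1 - length ys" by auto
    then show ?thesis unfolding new using snoc by simp
  qed
qed simp

lemma bar_drawing_gap_word:
  assumes "length ys = n - 1" and "decisions t n u (length (gap_word ys)) = gap_word ys"
  shows "bar_drawing t n u = Some (map (bars (replay t n (gap_word ys))) [1..<n])"
proof -
  have "(LEAST k. \<not> accepted (replay t n (decisions t n u k)) < n - 1) = length (gap_word ys)"
  proof (rule Least_equality)
    show "\<not> accepted (replay t n (decisions t n u (length (gap_word ys)))) < n - 1"
      unfolding assms(2) by (simp add: assms(1))
    fix k assume k: "\<not> accepted (replay t n (decisions t n u k)) < n - 1"
    show "length (gap_word ys) \<le> k"
    proof (rule ccontr)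
      assume "\<not> length (gap_word ys) \<le> k"
      then have "k < length (gap_word ys)" by simp
      moreover from this have "decisions t n u k = take k (gap_word ys)"
        by (metis assms(2) take_decisions less_imp_le)
      ultimately show False
        using k count_take_gap_word[of k ys] assms(1) by simp
    qed
  qed
  moreover have "\<exists>k. \<not> accepted (replay t n (decisions t n u k)) < n - 1"
    by (rule exI[of _ "length (gap_word ys)"], subst assms(2)) (simp add: assms(1))
  ultimately show ?thesis
    unfolding bar_drawing_decisions by (simp only: if_True assms(2))
qed

text \<open>
  The map \<open>phi\<close> takes differences of \<open>k l - l\<close>, which for these bars are the partial sums of
  \<open>xs\<close>.
\<close>

lemma phi_partial_sums:
  assumes "length xs = n" and "1 \<le> n" and "sum_list xs = t"
  shows "phi t (map (\<lambda>l. int l + int (sum_list (take l xs))) [1..<n]) = map int xs"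
proof -
  define ks where "ks = map (\<lambda>l. int l + int (sum_list (take l xs))) [1..<n]"
  have len: "length ks + 1 = n" using assms by (simp add: ks_def)
  have k: "(0 # ks) ! l = int l + int (sum_list (take l xs))" if "l < n" for l
    using that by (cases l) (auto simp: ks_def)
  have S: "sum_list (take (Suc l) xs) = sum_list (take l xs) + xs ! l" if "l < n" for l
    using that assms by (simp add: take_Suc_conv_app_nth)
  have "phi t ks ! i = int (xs ! i)" if "i < n" for i
  proof (cases "i = n - 1")
    case True
    have "t = sum_list (take (n - 1) xs) + xs ! (n - 1)"
      using S[of "n - 1"] assms by simp
    then show ?thesis
      using True assms len k[of "n - 1"] by (simp add: phi_def Let_def nth_append)
  next
    case False
    then have i: "Suc i < n" "i < n - 1" using that by auto
    then show ?thesis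
      using k[of "Suc i"] k[of i] S[of i] len
      by (simp add: phi_def Let_def nth_append)
  qed
  moreover have "length (phi t ks) = n"
    using len by (simp add: phi_def Let_def)
  ultimately show ?thesis
    using assms(1) unfolding ks_def by (intro nth_equalityI) auto
qed

lemma phi_bar_drawing_gap_word:
  assumes "length xs = n" and "1 \<le> n" and "sum_list xs = t"
    and "decisions t n u (length (gap_word (rev (tl xs)))) = gap_word (rev (tl xs))"
  shows "map_option (phi t) (bar_drawing t n u) = Some (map int xs)"
proof -
  let ?ys = "rev (tl xs)"
  have len: "length ?ys = n - 1" using assms by simp
  have bars: "bars (replay t n (gap_word ?ys)) l = int l + int (sum_list (take l xs))"
    if "1 \<le> l" "l < n" for l
  proof -
    have "take (n - l) ?ys = rev (drop l xs)"
      using that assms by (cases xs) (auto simp: take_rev drop_Cons')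
    moreover have "sum_list (take l xs) + sum_list (drop l xs) = t"
      using assms(3) by (metis append_take_drop_id sum_list_append)
    ultimately have "sum_list (take l xs) + sum_list (take (Suc (n - 1 - l)) ?ys) = t"
      using that by (simp add: Suc_diff_Suc sum_list_rev)
    moreover have "n - 1 - (n - 1 - l) = l" using that by simp
    ultimately show ?thesis
      using bars_replay_gap_word[of ?ys n "n - 1 - l" t] that len by (simp add: of_nat_diff)
  qed
  have "map (bars (replay t n (gap_word ?ys))) [1..<n] =
      map (\<lambda>l. int l + int (sum_list (take l xs))) [1..<n]"
    by (rule map_cong) (auto simp: bars)
  then show ?thesis
    using bar_drawing_gap_word[OF len assms(4)] phi_partial_sums[OF assms(1-3)]
    by (simp only: option.map)
qed

section \<open>The law of the decisions\<close>

lemma measurable_decisions: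
  assumes "\<And>m. U m \<in> borel_measurable M"
  shows "(\<lambda>\<omega>. decisions t n (\<lambda>m. U m \<omega>) k) \<in> M \<rightarrow>\<^sub>M count_space UNIV"
proof (induction k)
  case (Suc k)
  note [measurable] = assms Suc
  have "(\<lambda>\<omega>. bs @ [U k \<omega> < bar_threshold t n (replay t n bs)])
      \<in> M \<rightarrow>\<^sub>M count_space UNIV" for bs
    by measurable
  from measurable_compose_countable[OF this Suc] show ?case by simp
qed simp

lemma measurable_bar_drawing:
  assumes "\<And>m. U m \<in> borel_measurable M"
  shows "(\<lambda>\<omega>. bar_drawing t n (\<lambda>m. U m \<omega>)) \<in> M \<rightarrow>\<^sub>M count_space UNIV"
proof -
  let ?d = "\<lambda>k \<omega>. decisions t n (\<lambda>m. U m \<omega>) k"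
  let ?stop = "\<lambda>\<omega>. LEAST k. \<not> accepted (replay t n (?d k \<omega>)) < n - 1"
  note [measurable] = measurable_decisions[OF assms]
  have [measurable]: "?stop \<in> M \<rightarrow>\<^sub>M count_space UNIV"
    by measurable
  have [measurable]: "(\<lambda>\<omega>. ?d (?stop \<omega>) \<omega>) \<in> M \<rightarrow>\<^sub>M count_space UNIV"
    by (rule measurable_compose_countable) measurable
  show ?thesis
    unfolding bar_drawing_decisions by measurable
qed

lemma uniform_measure_unit_lessThan:
  assumes "0 \<le> c" "c \<le> (1::real)"
  shows "measure (uniform_measure lborel {0..1}) {..<c} = c"
proof -
  have "{0..1} \<inter> {..<c} = {0..<c}" using assms by auto
  then show ?thesis using assms by (simp add: measure_uniform_measure)
qed

lemma uniform_measure_unit_atLeast: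
  assumes "0 \<le> c" "c \<le> (1::real)"
  shows "measure (uniform_measure lborel {0..1}) {c..} = 1 - c"
proof -
  have "{0..1} \<inter> {c..} = {c..1}" using assms by auto
  then show ?thesis using assms by (simp add: measure_uniform_measure)
qed

text \<open>
  This is the proportion of the \<open>(n - 1)\<close>-element subsets of \<open>{1..t + n - 1}\<close> whose membership
  pattern, read from the top, starts with \<open>bs\<close>.  The last assumption says that enough integers
  remain to complete the sample; it keeps every threshold met on the way between \<open>0\<close> and \<open>1\<close>.
\<close>

lemma (in prob_space) prob_decisions:
  assumes indep: "indep_vars (\<lambda>_. borel) U UNIV"
    and unif: "\<And>m. distr M borel (U m) = uniform_measure lborel {0..1}"
    and "1 \<le> n" and "length bs \<le> t + n - 1" and "count_list bs True \<le> n - 1"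
    and "n - 1 - count_list bs True \<le> t + n - 1 - length bs"
  shows "prob {\<omega> \<in> space M. decisions t n (\<lambda>m. U m \<omega>) (length bs) = bs} =
    real ((t + n - 1 - length bs) choose (n - 1 - count_list bs True)) /
    real ((t + n - 1) choose (n - 1))"
proof -
  have U [measurable]: "U m \<in> borel_measurable M" for m
    using indep by (simp add: indep_vars_def)
  \<comment> \<open>the set in which a draw must lie to give decision \<open>b\<close> after the word \<open>bs\<close>\<close>
  define A :: "bool list \<Rightarrow> bool \<Rightarrow> real set" where
    "A bs b = (let c = bar_threshold t n (replay t n bs) in if b then {..<c} else {c..})" for bs b
  define q where "q bs b = measure (uniform_measure lborel {0..1}) (A bs b)" for bs b
  have A [measurable]: "A bs b \<in> sets borel" for bs b
    by (simp add: A_def Let_def)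
  have prod: "prob {\<omega> \<in> space M. decisions t n (\<lambda>m. U m \<omega>) (length bs) = bs} =
      (\<Prod>i<length bs. q (take i bs) (bs ! i))"
  proof (cases "bs = []")
    case False
    have "{\<omega> \<in> space M. decisions t n (\<lambda>m. U m \<omega>) (length bs) = bs} =
        (\<Inter>i\<in>{..<length bs}. U i -` A (take i bs) (bs ! i) \<inter> space M)"
      using False unfolding decisions_eq_iff by (auto simp: A_def Let_def not_less split: if_splits)
    also have "prob \<dots> = (\<Prod>i<length bs. prob (U i -` A (take i bs) (bs ! i) \<inter> space M))"
      using False by (intro indep_varsD[OF indep]) auto
    also have "\<dots> = (\<Prod>i<length bs. q (take i bs) (bs ! i))"
      unfolding q_def by (intro prod.cong refl, subst unif[symmetric]) (simp add: measure_distr)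
    finally show ?thesis .
  qed (simp add: prob_space)
  have "(\<Prod>i<length bs. q (take i bs) (bs ! i)) =
    real ((t + n - 1 - length bs) choose (n - 1 - count_list bs True)) /
    real ((t + n - 1) choose (n - 1))"
    using assms(4-6)
  proof (induction bs rule: rev_induct)
    case Nil
    have "(t + n - 1) choose (n - 1) > 0"
      by (subst zero_less_binomial_iff) simp
    then show ?case by simp
  next
    case (snoc b bs)
    define D where "D = t + n - 1 - length bs"
    define r where "r = n - 1 - count_list bs True"
    have D: "D > 0" "t + n - 1 - length (bs @ [b]) = D - 1"
      using snoc.prems by (auto simp: D_def)
    have r: "r \<le> D" "b \<Longrightarrow> r > 0" "n - 1 - count_list (bs @ [b]) True = (if b then r - 1 else r)"
      using snoc.prems \<open>1 \<le> n\<close> by (auto simp: D_def r_def split: if_splits)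
    have thr: "bar_threshold t n (replay t n bs) = real r / real D"
      unfolding D_def r_def using snoc.prems \<open>1 \<le> n\<close>
      by (intro bar_threshold_replay) (auto split: if_splits)
    have "real r / real D \<le> 1" using r D by simp
    then have q: "q bs b = (if b then real r / real D else 1 - real r / real D)"
      using uniform_measure_unit_lessThan[of "real r / real D"]
        uniform_measure_unit_atLeast[of "real r / real D"]
      by (simp add: q_def A_def Let_def thr)
    have "real (D choose r) * q bs b = real ((D - 1) choose (if b then r - 1 else r))"
    proof (cases b)
      case True
      have "real r * real (D choose r) = real D * real ((D - 1) choose (r - 1))"
        using r(2)[OF True] binomial_absorption[of "r - 1" D]
        by (metis Suc_diff_1 of_nat_mult)
      then have "real (D choose r) * (real r / real D) = real ((D - 1) choose (r - 1))"
        using D(1) by (simp add: field_simps)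
      then show ?thesis using True q by simp
    next
      case False
      have "real (D - r) * real (D choose r) = real D * real ((D - 1) choose r)"
        using binomial_absorb_comp[of D r] by (metis of_nat_mult)
      then have "real (D choose r) * (1 - real r / real D) = real ((D - 1) choose r)"
        using D(1) r(1) by (simp add: field_simps of_nat_diff)
      then show ?thesis using False q by simp
    qed
    moreover have "(\<Prod>i<length bs. q (take i bs) (bs ! i)) =
        real (D choose r) / real ((t + n - 1) choose (n - 1))"
      unfolding D_def r_def using snoc.prems
      by (intro snoc.IH) (auto split: if_splits)
    moreover have "(\<Prod>i<length (bs @ [b]). q (take i (bs @ [b])) ((bs @ [b]) ! i)) =
        (\<Prod>i<length bs. q (take i bs) (bs ! i)) * q bs b"
      by (simp add: nth_append)
    ultimately show ?case
      unfolding D(2) r(3) by simp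
  qed
  with prod show ?thesis by simp
qed

section \<open>Uniformity of both laws\<close>

text \<open>
  Lower bounds suffice: on \<open>S\<close> they already add up to the total mass \<open>1\<close>, which leaves no room
  for a strict inequality or for mass outside \<open>S\<close>.
\<close>

lemma eq_pmf_of_setI:
  assumes "prob_space \<mu>" and sets: "sets \<mu> = UNIV"
    and S: "finite S" "S \<noteq> {}" and ge: "\<And>x. x \<in> S \<Longrightarrow> 1 / real (card S) \<le> measure \<mu> {x}"
  shows "\<mu> = measure_pmf (pmf_of_set S)"
proof -
  interpret prob_space \<mu> by fact
  have sum: "measure \<mu> S = (\<Sum>x\<in>S. measure \<mu> {x})"
    using S by (intro finite_measure_eq_sum_singleton) (auto simp: sets)
  have one: "(\<Sum>x\<in>S. 1 / real (card S)) = 1" using S by simp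
  have "(\<Sum>x\<in>S. measure \<mu> {x} - 1 / real (card S)) \<le> 0"
    using prob_le_1[of S] by (simp only: sum_subtractf one sum[symmetric] diff_le_0_iff_le)
  moreover have nonneg: "\<And>x. x \<in> S \<Longrightarrow> 0 \<le> measure \<mu> {x} - 1 / real (card S)"
    using ge by simp
  ultimately have "(\<Sum>x\<in>S. measure \<mu> {x} - 1 / real (card S)) = 0"
    by (meson antisym sum_nonneg)
  then have eq: "measure \<mu> {x} = 1 / real (card S)" if "x \<in> S" for x
    using that sum_nonneg_eq_0_iff[OF S(1) nonneg] by simp
  have "measure \<mu> S = 1" unfolding sum using one eq by simp
  then have "AE x in \<mu>. x \<in> S"
    by (simp add: sets prob_eq_1)
  then show ?thesis
    using S by (intro measure_eqI_countable_AE[where \<Omega> = S])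
      (auto simp: sets AE_measure_pmf_iff countable_finite emeasure_eq_measure eq
         measure_pmf.emeasure_eq_measure measure_pmf_single)
qed

lemma measurable_map_count_space:
  fixes X :: "'i \<Rightarrow> 'b \<Rightarrow> 'c::countable"
  assumes "\<And>i. i \<in> set is \<Longrightarrow> X i \<in> M \<rightarrow>\<^sub>M count_space UNIV"
  shows "(\<lambda>\<omega>. map (\<lambda>i. X i \<omega>) is) \<in> M \<rightarrow>\<^sub>M count_space UNIV"
  using assms
proof (induction "is")
  case (Cons i "is")
  have tl: "(\<lambda>\<omega>. map (\<lambda>i. X i \<omega>) is) \<in> M \<rightarrow>\<^sub>M count_space UNIV"
    and [measurable]: "X i \<in> M \<rightarrow>\<^sub>M count_space UNIV"
    using Cons by auto
  have "(\<lambda>\<omega>. X i \<omega> # xs) \<in> M \<rightarrow>\<^sub>M count_space UNIV" for xs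
    by measurable
  from measurable_compose_countable[OF this tl] show ?case by simp
qed simp

definition weak_compositions :: "nat \<Rightarrow> nat \<Rightarrow> nat list set" where
  "weak_compositions n t = {xs. length xs = n \<and> sum_list xs = t}"

lemma card_weak_compositions:
  assumes "1 \<le> n"
  shows "card (weak_compositions n t) = (t + n - 1) choose (n - 1)"
proof -
  have "card (weak_compositions n t) = (t + n - 1) choose t"
    unfolding weak_compositions_def by (rule card_length_sum_list)
  also have "\<dots> = (t + n - 1) choose (n - 1)"
    using assms binomial_symmetric[of t "t + n - 1"] by simp
  finally show ?thesis .
qed

lemma card_weak_compositions_pos: "1 \<le> n \<Longrightarrow> 0 < card (weak_compositions n t)"
  by (simp add: card_weak_compositions)

lemma distr_bar_drawing:
  assumes "prob_space M" and indep: "prob_space.indep_vars M (\<lambda>_. borel) U UNIV"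
    and unif: "\<And>m. distr M borel (U m) = uniform_measure lborel {0..1}" and "1 \<le> n"
  shows "distr M (count_space UNIV)
      (\<lambda>\<omega>. map_option (phi t) (bar_drawing t n (\<lambda>m. U m \<omega>))) =
    measure_pmf (pmf_of_set ((\<lambda>xs. Some (map int xs)) ` weak_compositions n t))"
proof -
  interpret prob_space M by fact
  let ?out = "\<lambda>\<omega>. map_option (phi t) (bar_drawing t n (\<lambda>m. U m \<omega>))"
  let ?F = "\<lambda>xs. Some (map int xs)" and ?W = "weak_compositions n t"
  have U: "U m \<in> borel_measurable M" for m
    using indep by (simp add: indep_vars_def)
  note [measurable] = measurable_bar_drawing[OF U] measurable_decisions[OF U]
  have out [measurable]: "?out \<in> M \<rightarrow>\<^sub>M count_space UNIV" by measurable
  have inj: "inj_on ?F ?W" by (auto intro!: inj_onI simp: inj_map_eq_map)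
  have pos: "0 < card ?W" using \<open>1 \<le> n\<close> by (rule card_weak_compositions_pos)
  then have fin: "finite ?W" "?W \<noteq> {}" by (auto intro: card_ge_0_finite)
  have "1 / real (card ?W) \<le> prob (?out -` {?F xs} \<inter> space M)" if "xs \<in> ?W" for xs
  proof -
    let ?w = "gap_word (rev (tl xs))"
    have xs: "length xs = n" "sum_list xs = t"
      using that by (auto simp: weak_compositions_def)
    have len: "length (tl xs) = n - 1" "sum_list (tl xs) \<le> t"
      using xs by (auto simp: tl_def split: list.splits)
    have "prob {\<omega> \<in> space M. decisions t n (\<lambda>m. U m \<omega>) (length ?w) = ?w} = 1 / real (card ?W)"
      using prob_decisions[OF indep unif \<open>1 \<le> n\<close>, of ?w t] len \<open>1 \<le> n\<close>
      by (simp add: card_weak_compositions sum_list_rev)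
    moreover have "prob {\<omega> \<in> space M. decisions t n (\<lambda>m. U m \<omega>) (length ?w) = ?w} \<le>
        prob (?out -` {?F xs} \<inter> space M)"
      using phi_bar_drawing_gap_word[OF xs(1) \<open>1 \<le> n\<close> xs(2)]
      by (intro finite_measure_mono measurable_sets[OF out]) auto
    ultimately show ?thesis by simp
  qed
  then show ?thesis
    using fin by (intro eq_pmf_of_setI prob_space_distr out)
      (auto simp: card_image[OF inj] measure_distr)
qed

text \<open>
  The constant mass \<open>p ^ n * (1 - p) ^ t\<close> of the compositions cancels against the probability of
  the conditioning event, which is that mass times the number of compositions.
\<close>

lemma (in prob_space) cond_law_geometric:
  assumes "1 \<le> n" and "0 < p" and "p < 1"
    and indep: "indep_vars (\<lambda>_. count_space UNIV) X {1..n}"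
    and geom: "\<And>i. i \<in> {1..n} \<Longrightarrow>
           distr M (count_space UNIV) (X i) = measure_pmf (geometric_pmf p)"
  shows "cond_law M {\<omega> \<in> space M. (\<Sum>i = 1..n. X i \<omega>) = t} (count_space UNIV)
      (\<lambda>\<omega>. Some (map (\<lambda>i. int (X i \<omega>)) [1..<n + 1])) =
    measure_pmf (pmf_of_set ((\<lambda>xs. Some (map int xs)) ` weak_compositions n t))"
proof -
  define Y where "Y \<omega> = map (\<lambda>i. X i \<omega>) [1..<n + 1]" for \<omega>
  let ?F = "\<lambda>xs. Some (map int xs)" and ?W = "weak_compositions n t"
  define E where "E = {\<omega> \<in> space M. (\<Sum>i = 1..n. X i \<omega>) = t}"
  let ?c = "p ^ n * (1 - p) ^ t"
  have X: "X i \<in> M \<rightarrow>\<^sub>M count_space UNIV" if "i \<in> {1..n}" for i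
    using indep that by (simp add: indep_vars_def)
  have mX [measurable]: "Y \<in> M \<rightarrow>\<^sub>M count_space UNIV"
    unfolding Y_def by (intro measurable_map_count_space X) auto
  have inj: "inj_on ?F ?W" by (auto intro!: inj_onI simp: inj_map_eq_map)
  have pos: "0 < card ?W" using \<open>1 \<le> n\<close> by (rule card_weak_compositions_pos)
  then have fin: "finite ?W" "?W \<noteq> {}" by (auto intro: card_ge_0_finite)
  have lenY: "length (Y \<omega>) = n" for \<omega>
    by (simp add: Y_def del: upt_Suc)
  have sumX: "(\<Sum>i = 1..n. X i \<omega>) = sum_list (Y \<omega>)" for \<omega>
    by (simp add: Y_def interv_sum_list_conv_sum_set_nat atLeastLessThanSuc_atLeastAtMost del: upt_Suc)
  have E_eq: "E = (\<Union>xs\<in>?W. {\<omega> \<in> space M. Y \<omega> = xs})"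
    unfolding E_def sumX weak_compositions_def using lenY by auto
  have mass: "prob {\<omega> \<in> space M. Y \<omega> = xs} = ?c" if "xs \<in> ?W" for xs
  proof -
    have xs: "length xs = n" "sum_list xs = t"
      using that by (auto simp: weak_compositions_def)
    have "Y \<omega> = xs \<longleftrightarrow> (\<forall>i\<in>{1..n}. X i \<omega> = xs ! (i - 1))" for \<omega>
    proof -
      have "Y \<omega> = xs \<longleftrightarrow> (\<forall>i<n. X (Suc i) \<omega> = xs ! i)"
        using xs by (simp add: Y_def list_eq_iff_nth_eq del: upt_Suc)
      also have "\<dots> \<longleftrightarrow> (\<forall>i\<in>Suc ` {..<n}. X i \<omega> = xs ! (i - 1))"
        by auto
      also have "Suc ` {..<n} = {1..n}"
        by (simp add: image_Suc_lessThan)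
      finally show ?thesis .
    qed
    then have "{\<omega> \<in> space M. Y \<omega> = xs} = (\<Inter>i\<in>{1..n}. X i -` {xs ! (i - 1)} \<inter> space M)"
      using \<open>1 \<le> n\<close> by auto
    also have "prob \<dots> = (\<Prod>i\<in>{1..n}. prob (X i -` {xs ! (i - 1)} \<inter> space M))"
      using \<open>1 \<le> n\<close> by (intro indep_varsD[OF indep]) auto
    also have "\<dots> = (\<Prod>i\<in>{1..n}. (1 - p) ^ (xs ! (i - 1)) * p)"
    proof (intro prod.cong refl)
      fix i assume i: "i \<in> {1..n}"
      then show "prob (X i -` {xs ! (i - 1)} \<inter> space M) = (1 - p) ^ (xs ! (i - 1)) * p"
        using X[OF i] \<open>0 < p\<close> \<open>p < 1\<close>
        by (simp add: geom[OF i] measure_pmf_single flip: measure_distr)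
    qed
    also have "\<dots> = (\<Prod>i<n. (1 - p) ^ (xs ! i) * p)"
      by (rule prod.reindex_bij_witness[of _ Suc "\<lambda>i. i - 1"]) auto
    also have "\<dots> = ?c"
      using xs by (simp add: prod.distrib sum_list_sum_nth atLeast0LessThan flip: power_sum)
    finally show ?thesis .
  qed
  have [measurable]: "{\<omega> \<in> space M. Y \<omega> = xs} \<in> events" for xs by measurable
  have PE: "prob E = real (card ?W) * ?c"
    unfolding E_eq using fin
    by (subst finite_measure_finite_Union) (auto simp: disjoint_family_on_def mass)
  have ne: "emeasure M E \<noteq> 0"
    using PE pos \<open>0 < p\<close> \<open>p < 1\<close> by (auto simp: emeasure_eq_measure)
  interpret C: prob_space "uniform_measure M E"
    by (rule prob_space_uniform_measure) (auto simp: ne)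
  have mF: "(\<lambda>\<omega>. ?F (Y \<omega>)) \<in> uniform_measure M E \<rightarrow>\<^sub>M count_space UNIV"
    by measurable
  have "1 / real (card ?W) \<le> measure (distr (uniform_measure M E) (count_space UNIV)
      (\<lambda>\<omega>. ?F (Y \<omega>))) {?F xs}" if "xs \<in> ?W" for xs
  proof -
    have eq: "(\<lambda>\<omega>. ?F (Y \<omega>)) -` {?F xs} \<inter> space M = {\<omega> \<in> space M. Y \<omega> = xs}"
      by (auto simp: inj_map_eq_map)
    have "E \<inter> {\<omega> \<in> space M. Y \<omega> = xs} = {\<omega> \<in> space M. Y \<omega> = xs}"
      using that unfolding E_eq by blast
    then show ?thesis
      using \<open>0 < p\<close> \<open>p < 1\<close> by (subst measure_distr[OF mF])
        (simp_all add: eq measure_uniform_measure ne mass[OF that] PE)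
  qed
  then have "distr (uniform_measure M E) (count_space UNIV) (\<lambda>\<omega>. ?F (Y \<omega>)) =
      measure_pmf (pmf_of_set (?F ` ?W))"
    using fin by (intro eq_pmf_of_setI C.prob_space_distr mF) (auto simp: card_image[OF inj])
  then show ?thesis
    by (simp add: cond_law_def E_def Y_def comp_def del: upt_Suc)
qed

theorem mainTheorem3:
  fixes t n :: nat and p :: real
    and M :: "'a measure" and U :: "nat \<Rightarrow> 'a \<Rightarrow> real"
    and M' :: "'b measure" and X :: "nat \<Rightarrow> 'b \<Rightarrow> nat"
  assumes "t \<ge> 1" and "n \<ge> 1" and "0 < p" and "p < 1"
    and "prob_space M"
    and "prob_space.indep_vars M (\<lambda>_. borel) U UNIV"
    and "\<And>m. distr M borel (U m) = uniform_measure lborel {0..1}"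
    and "prob_space M'"
    and "prob_space.indep_vars M' (\<lambda>_. count_space UNIV) X {1..n}"
    and "\<And>i. i \<in> {1..n} \<Longrightarrow>
           distr M' (count_space UNIV) (X i) = measure_pmf (geometric_pmf p)"
  shows "(\<lambda>\<omega>. map_option (phi t) (bar_drawing t n (\<lambda>m. U m \<omega>))) \<in> M \<rightarrow>\<^sub>M count_space UNIV \<and>
         distr M (count_space UNIV)
           (\<lambda>\<omega>. map_option (phi t) (bar_drawing t n (\<lambda>m. U m \<omega>))) =
         cond_law M' {\<omega> \<in> space M'. (\<Sum>i = 1..n. X i \<omega>) = t} (count_space UNIV)
           (\<lambda>\<omega>. Some (map (\<lambda>i. int (X i \<omega>)) [1..<n + 1]))"
proof
  have "U m \<in> borel_measurable M" for m
    using assms(5,6) by (simp add: prob_space.indep_vars_def)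
  note [measurable] = measurable_bar_drawing[OF this]
  show "(\<lambda>\<omega>. map_option (phi t) (bar_drawing t n (\<lambda>m. U m \<omega>))) \<in> M \<rightarrow>\<^sub>M count_space UNIV"
    by measurable
  show "distr M (count_space UNIV)
           (\<lambda>\<omega>. map_option (phi t) (bar_drawing t n (\<lambda>m. U m \<omega>))) =
         cond_law M' {\<omega> \<in> space M'. (\<Sum>i = 1..n. X i \<omega>) = t} (count_space UNIV)
           (\<lambda>\<omega>. Some (map (\<lambda>i. int (X i \<omega>)) [1..<n + 1]))"
    using distr_bar_drawing[OF assms(5-7,2)]
      prob_space.cond_law_geometric[OF assms(8,2-4,9,10)] by simp
qed

end
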